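(* Let $\Gamma$ be a second countable locally compact Hausdorff groupoid, let $p:B\to C$ be a surjective (continuous) homomorphism of second countable locally compact Hausdorff abelian groups, and let $\phi:\Gamma\to C$ be a continuous $1$-cocycle. Put $$\Sigma_\phi=\{(\gamma,b)\in\Gamma\times B:\phi(\gamma)=p(b)\}.$$ Then $\Sigma_\phi$ is a closed subgroupoid of $\Gamma\times B$ and it is a twist of $\Gamma$ by $A:=\ker p$. $\Sigma_\phi$ is properly isomorphic to the trivial twist $\Gamma\times A$ if and only if there is a continuous $1$-cocycle $\tilde\phi:\Gamma\to B$ such that $\phi=p\circ\tilde\phi$. The projection $\pi_1:\Sigma_\phi\to\Gamma$, $\pi_1(\gamma,b)=\gamma$, is a surjective groupoid morphism. If $\Gamma$ is étale and $A$ is discrete, then $\Sigma_\phi$ is étale and $\pi_1$ is a local homeomorphism.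
   Context: All groupoids are second countable, locally compact and Hausdorff and possess Haar systems. A continuous $1$-cocycle $\Gamma\to G$ ($G$ an abelian group) is a continuous map $\phi$ with $\phi(\gamma_1\gamma_2)=\phi(\gamma_1)+\phi(\gamma_2)$ for composable $\gamma_1,\gamma_2$. $\Gamma\times B$ is the product groupoid: $(\gamma_1,b_1)(\gamma_2,b_2)=(\gamma_1\gamma_2,b_1+b_2)$ when $s(\gamma_1)=r(\gamma_2)$, and $(\gamma,b)^{-1}=(\gamma^{-1},-b)$. Its unit space $\Gamma^0\times\{0\}$ is identified with $\Gamma^0$. A twist by a (locally compact abelian) group $A$ over $\Gamma$ is a central extension of topological groupoids $$\Gamma^0\times A\xrightarrow{j}\Sigma\xrightarrow{\pi}\Gamma,$$ where $\Sigma^0=\Gamma^0$, $j$ is injective (a homeomorphism onto $\pi^{-1}(\Gamma^0)$), $\pi$ is surjective (continuous and open), both are groupoid homomorphisms restricting to the identity on $\Gamma^0$, and $j(r(\sigma),a)\sigma=\sigma j(s(\sigma),a)$ for all $\sigma\in\Sigma$, $a\in A$. For $\Sigma_\phi$ the maps are $j(u,a)=(u,a)$ and $\pi=\pi_1$. The trivial twist is $\Gamma\times A$ with $j_0(u,a)=(u,a)$ and $\pi_0(\gamma,a)=\gamma$. Two twists $(\Sigma,j,\pi)$ and $(\Sigma',j',\pi')$ by $A$ over $\Gamma$ are properly isomorphic if there is a twist morphism between them preserving the inclusion of $\Gamma^0\times A$, i.e. a continuous groupoid homomorphism $f:\Sigma\to\Sigma'$ with $\pi'\circ f=\pi$ and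 $f\circ j=j'$. *)

theory Defs
  imports "HOL-Analysis.Analysis"
begin

section \<open>Topological groupoids\<close>

text \<open>The set of arrows is \<open>topspace (gtop G)\<close>; outside of it (and, for \<open>gmul\<close>, on pairs that are not
  composable) the operations are unconstrained.  A pair \<open>(x, y)\<close> is composable iff
  \<open>gsrc x = grng y\<close>.\<close>

record 'a tgroupoid =
  gtop :: "'a topology"
  gmul :: "'a \<Rightarrow> 'a \<Rightarrow> 'a"
  ginv :: "'a \<Rightarrow> 'a"
  gsrc :: "'a \<Rightarrow> 'a"
  grng :: "'a \<Rightarrow> 'a"

abbreviation arrows :: "'a tgroupoid \<Rightarrow> 'a set"
  where "arrows G \<equiv> topspace (gtop G)"

definition units :: "'a tgroupoid \<Rightarrow> 'a set"
  where "units G = gsrc G ` arrows G"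

definition composable :: "'a tgroupoid \<Rightarrow> ('a \<times> 'a) set"
  where "composable G = {(x, y). x \<in> arrows G \<and> y \<in> arrows G \<and> gsrc G x = grng G y}"

locale groupoid =
  fixes G :: "'a tgroupoid"
  assumes src_closed: "x \<in> arrows G \<Longrightarrow> gsrc G x \<in> arrows G"
    and rng_closed: "x \<in> arrows G \<Longrightarrow> grng G x \<in> arrows G"
    and inv_closed: "x \<in> arrows G \<Longrightarrow> ginv G x \<in> arrows G"
    and mul_closed: "(x, y) \<in> composable G \<Longrightarrow> gmul G x y \<in> arrows G"
    and src_src: "x \<in> arrows G \<Longrightarrow> gsrc G (gsrc G x) = gsrc G x"
    and rng_src: "x \<in> arrows G \<Longrightarrow> grng G (gsrc G x) = gsrc G x"
    and src_rng: "x \<in> arrows G \<Longrightarrow> gsrc G (grng G x) = grng G x"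
    and rng_rng: "x \<in> arrows G \<Longrightarrow> grng G (grng G x) = grng G x"
    and src_mul: "(x, y) \<in> composable G \<Longrightarrow> gsrc G (gmul G x y) = gsrc G y"
    and rng_mul: "(x, y) \<in> composable G \<Longrightarrow> grng G (gmul G x y) = grng G x"
    and mul_assoc: "(x, y) \<in> composable G \<Longrightarrow> (y, z) \<in> composable G \<Longrightarrow>
                    gmul G (gmul G x y) z = gmul G x (gmul G y z)"
    and rng_mul_left: "x \<in> arrows G \<Longrightarrow> gmul G (grng G x) x = x"
    and mul_src_right: "x \<in> arrows G \<Longrightarrow> gmul G x (gsrc G x) = x"
    and src_inv: "x \<in> arrows G \<Longrightarrow> gsrc G (ginv G x) = grng G x"
    and rng_inv: "x \<in> arrows G \<Longrightarrow> grng G (ginv G x) = gsrc G x"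
    and mul_inv_right: "x \<in> arrows G \<Longrightarrow> gmul G x (ginv G x) = grng G x"
    and mul_inv_left: "x \<in> arrows G \<Longrightarrow> gmul G (ginv G x) x = gsrc G x"

locale topological_groupoid = groupoid +
  assumes continuous_mul:
    "continuous_map (subtopology (prod_topology (gtop G) (gtop G)) (composable G)) (gtop G)
       (\<lambda>(x, y). gmul G x y)"
    and continuous_inv: "continuous_map (gtop G) (gtop G) (ginv G)"

locale lcsc_groupoid = topological_groupoid +
  assumes second_countable: "second_countable (gtop G)"
    and locally_compact: "locally_compact_space (gtop G)"
    and Hausdorff: "Hausdorff_space (gtop G)"

definition groupoid_hom :: "'a tgroupoid \<Rightarrow> 'b tgroupoid \<Rightarrow> ('a \<Rightarrow> 'b) \<Rightarrow> bool"
  where "groupoid_hom G H f \<longleftrightarrow>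
    f ` arrows G \<subseteq> arrows H \<and>
    (\<forall>(x, y) \<in> composable G. (f x, f y) \<in> composable H \<and> f (gmul G x y) = gmul H (f x) (f y))"

definition subgroupoid :: "'a set \<Rightarrow> 'a tgroupoid \<Rightarrow> bool"
  where "subgroupoid S G \<longleftrightarrow>
    S \<subseteq> arrows G \<and>
    (\<forall>x \<in> S. ginv G x \<in> S) \<and>
    (\<forall>x \<in> S. \<forall>y \<in> S. (x, y) \<in> composable G \<longrightarrow> gmul G x y \<in> S)"

definition restrict_groupoid :: "'a tgroupoid \<Rightarrow> 'a set \<Rightarrow> 'a tgroupoid"
  where "restrict_groupoid G S = G\<lparr>gtop := subtopology (gtop G) S\<rparr>"

text \<open>The product of \<open>G\<close> with a subgroup \<open>A\<close> of a topological abelian group; the whole group is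
  \<open>A = UNIV\<close>.\<close>

definition prod_groupoid ::
    "'a tgroupoid \<Rightarrow> 'b::topological_ab_group_add set \<Rightarrow> ('a \<times> 'b) tgroupoid"
  where "prod_groupoid G A =
    \<lparr>gtop = prod_topology (gtop G) (top_of_set A),
     gmul = (\<lambda>(x, a) (y, b). (gmul G x y, a + b)),
     ginv = (\<lambda>(x, a). (ginv G x, - a)),
     gsrc = (\<lambda>(x, a). (gsrc G x, 0)),
     grng = (\<lambda>(x, a). (grng G x, 0))\<rparr>"


section \<open>Haar systems\<close>

definition compactly_supported_continuous :: "'a topology \<Rightarrow> ('a \<Rightarrow> complex) set"
  where "compactly_supported_continuous X =
    {f. continuous_map X euclidean f \<and> compactin X (X closure_of {x \<in> topspace X. f x \<noteq> 0})}"

text \<open>A left Haar system.  Each \<open>\<mu> u\<close> is a Borel measure finite on compact sets, which for a second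
  countable locally compact Hausdorff space is the same as a Radon measure.  The second conjunct
  says that the support of \<open>\<mu> u\<close> is the range fibre over \<open>u\<close>.\<close>

definition haar_system :: "'a tgroupoid \<Rightarrow> ('a \<Rightarrow> 'a measure) \<Rightarrow> bool"
  where "haar_system G \<mu> \<longleftrightarrow>
    (\<forall>u \<in> units G.
       sets (\<mu> u) = sigma_sets (arrows G) {U. openin (gtop G) U} \<and>
       (\<forall>K. compactin (gtop G) K \<longrightarrow> emeasure (\<mu> u) K < \<infinity>)) \<and>
    (\<forall>u \<in> units G.
       {x \<in> arrows G. \<forall>U. openin (gtop G) U \<and> x \<in> U \<longrightarrow> emeasure (\<mu> u) U \<noteq> 0}
         = {x \<in> arrows G. grng G x = u}) \<and>
    (\<forall>f \<in> compactly_supported_continuous (gtop G).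
       continuous_map (subtopology (gtop G) (units G)) euclidean (\<lambda>u. \<integral>x. f x \<partial>\<mu> u)) \<and>
    (\<forall>f \<in> compactly_supported_continuous (gtop G). \<forall>x \<in> arrows G.
       (\<integral>y. indicator {y \<in> arrows G. grng G y = gsrc G x} y *\<^sub>R f (gmul G x y) \<partial>\<mu> (gsrc G x))
         = (\<integral>y. f y \<partial>\<mu> (grng G x)))"


section \<open>Etale groupoids\<close>

definition local_homeomorphism :: "'a topology \<Rightarrow> 'b topology \<Rightarrow> ('a \<Rightarrow> 'b) \<Rightarrow> bool"
  where "local_homeomorphism X Y f \<longleftrightarrow>
    f ` topspace X \<subseteq> topspace Y \<and>
    (\<forall>x \<in> topspace X. \<exists>U. openin X U \<and> x \<in> U \<and> openin Y (f ` U) \<and>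
       homeomorphic_map (subtopology X U) (subtopology Y (f ` U)) f)"

definition etale :: "'a tgroupoid \<Rightarrow> bool"
  where "etale G \<longleftrightarrow> topological_groupoid G \<and>
    local_homeomorphism (gtop G) (subtopology (gtop G) (units G)) (grng G) \<and>
    local_homeomorphism (gtop G) (subtopology (gtop G) (units G)) (gsrc G)"


section \<open>Twists\<close>

definition additive_subgroup :: "'b::ab_group_add set \<Rightarrow> bool"
  where "additive_subgroup A \<longleftrightarrow> 0 \<in> A \<and> (\<forall>a \<in> A. \<forall>b \<in> A. a + b \<in> A) \<and> (\<forall>a \<in> A. - a \<in> A)"

definition group_bundle ::
    "'a tgroupoid \<Rightarrow> 'b::topological_ab_group_add set \<Rightarrow> ('a \<times> 'b) tgroupoid"
  where "group_bundle G A = restrict_groupoid (prod_groupoid G A) (units G \<times> A)"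

text \<open>The unit spaces of \<open>E\<close> and of \<open>G\<close> are sets in different types; the identification of
  \<open>units G\<close> with \<open>units E\<close> is \<open>u \<mapsto> j (u, 0)\<close>.  That \<open>j\<close> and \<open>\<pi>\<close> are the identity on units is
  the pair of conditions \<open>units E = (\<lambda>u. j (u, 0)) ` units G\<close> and \<open>\<pi> (j (u, 0)) = u\<close>, and
  the unit of \<open>G\<close> identified with \<open>r(\<sigma>)\<close> is \<open>\<pi> (r(\<sigma>)) = r(\<pi>(\<sigma>))\<close>.\<close>

definition twist ::
    "'a tgroupoid \<Rightarrow> 'b::topological_ab_group_add set \<Rightarrow>
     'e tgroupoid \<Rightarrow> ('a \<times> 'b \<Rightarrow> 'e) \<Rightarrow> ('e \<Rightarrow> 'a) \<Rightarrow> bool"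
  where "twist G A E j \<pi> \<longleftrightarrow>
    lcsc_groupoid G \<and> lcsc_groupoid E \<and>
    additive_subgroup A \<and>
    locally_compact_space (top_of_set A) \<and> Hausdorff_space (top_of_set A) \<and>
    groupoid_hom (group_bundle G A) E j \<and>
    homeomorphic_map (gtop (group_bundle G A))
      (subtopology (gtop E) {x \<in> arrows E. \<pi> x \<in> units G}) j \<and>
    groupoid_hom E G \<pi> \<and>
    continuous_map (gtop E) (gtop G) \<pi> \<and> open_map (gtop E) (gtop G) \<pi> \<and>
    \<pi> ` arrows E = arrows G \<and>
    units E = (\<lambda>u. j (u, 0)) ` units G \<and>
    (\<forall>u \<in> units G. \<pi> (j (u, 0)) = u) \<and>
    (\<forall>x \<in> arrows E. \<forall>a \<in> A.
       gmul E (j (\<pi> (grng E x), a)) x = gmul E x (j (\<pi> (gsrc E x), a)))"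

definition properly_isomorphic ::
    "'a tgroupoid \<Rightarrow> 'b::topological_ab_group_add set \<Rightarrow>
     'e tgroupoid \<Rightarrow> ('a \<times> 'b \<Rightarrow> 'e) \<Rightarrow> ('e \<Rightarrow> 'a) \<Rightarrow>
     'f tgroupoid \<Rightarrow> ('a \<times> 'b \<Rightarrow> 'f) \<Rightarrow> ('f \<Rightarrow> 'a) \<Rightarrow> bool"
  where "properly_isomorphic G A E j \<pi> E' j' \<pi>' \<longleftrightarrow>
    twist G A E j \<pi> \<and> twist G A E' j' \<pi>' \<and>
    (\<exists>f. groupoid_hom E E' f \<and> continuous_map (gtop E) (gtop E') f \<and>
         (\<forall>x \<in> arrows E. \<pi>' (f x) = \<pi> x) \<and>
         (\<forall>u \<in> units G. \<forall>a \<in> A. f (j (u, a)) = j' (u, a)))"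


section \<open>The groupoid defined by a cocycle\<close>

definition continuous_cocycle ::
    "'a tgroupoid \<Rightarrow> ('a \<Rightarrow> 'c::topological_ab_group_add) \<Rightarrow> bool"
  where "continuous_cocycle G \<phi> \<longleftrightarrow>
    continuous_map (gtop G) euclidean \<phi> \<and>
    (\<forall>(x, y) \<in> composable G. \<phi> (gmul G x y) = \<phi> x + \<phi> y)"

definition hom_kernel :: "('b \<Rightarrow> 'c::zero) \<Rightarrow> 'b set"
  where "hom_kernel p = {b. p b = 0}"

definition Sigma_set :: "'a tgroupoid \<Rightarrow> ('b \<Rightarrow> 'c) \<Rightarrow> ('a \<Rightarrow> 'c) \<Rightarrow> ('a \<times> 'b) set"
  where "Sigma_set G p \<phi> = {(x, b). x \<in> arrows G \<and> \<phi> x = p b}"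

definition Sigma_groupoid ::
    "'a tgroupoid \<Rightarrow> ('b::topological_ab_group_add \<Rightarrow> 'c) \<Rightarrow> ('a \<Rightarrow> 'c) \<Rightarrow> ('a \<times> 'b) tgroupoid"
  where "Sigma_groupoid G p \<phi> = restrict_groupoid (prod_groupoid G UNIV) (Sigma_set G p \<phi>)"

end

(* A surjective continuous homomorphism of second countable locally compact groups is open.  Hence the
   projection from Sigma to the base groupoid is open, so it is a quotient map: a proper isomorphism
   onto the trivial twist descends along it to a lift of the cocycle, and conversely a lift psi gives
   the isomorphism (x, b) |-> (x, b - psi x).  The trivial twist is itself Sigma for the zero cocycle.
   When the kernel is discrete the projection is locally injective, hence a local homeomorphism, and
   range and source of Sigma are those of the base composed with it. *)

theory Submission
  imports Defs
begin

section \<open>Topological groups and local homeomorphisms\<close>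

text \<open>Openness of \<open>p\<close> is where the topological hypotheses on the groups meet:
  second countability of the domain gives countably many translates, its local compactness gives a
  compact set to translate, and local compactness of the Hausdorff target makes Baire's theorem
  available. Openness serves twice: a twist must have an open projection, and the descent of a
  trivialisation needs a quotient map. The quotient map replaces a continuous section of the
  projection, which cannot be presupposed: a multiplicative continuous section
  \<open>x |-> (x, psi x)\<close> is itself a lift of the cocycle. So points of the fibres are
  chosen arbitrarily and each is compared with its image; the comparison does not depend on the
  choice. Groupoids carry their topology as a value, the groups carry theirs through type classes,
  and several auxiliary facts only pass between the two.\<close>

lemma continuous_map_group_add:
  fixes f g :: "'a \<Rightarrow> 'b::topological_monoid_add"
  assumes "continuous_map X euclidean f" "continuous_map X euclidean g"
  shows "continuous_map X euclidean (\<lambda>x. f x + g x)"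
  using assms by (simp add: continuous_map_atin tendsto_add)

lemma continuous_map_group_minus:
  fixes f :: "'a \<Rightarrow> 'b::topological_group_add"
  assumes "continuous_map X euclidean f"
  shows "continuous_map X euclidean (\<lambda>x. - f x)"
  using assms by (simp add: continuous_map_atin tendsto_minus)

lemma continuous_map_group_diff:
  fixes f g :: "'a \<Rightarrow> 'b::topological_group_add"
  assumes "continuous_map X euclidean f" "continuous_map X euclidean g"
  shows "continuous_map X euclidean (\<lambda>x. f x - g x)"
  using continuous_map_group_add[OF assms(1) continuous_map_group_minus[OF assms(2)]] by simp

lemma Hausdorff_space_euclidean_t2: "Hausdorff_space (euclidean :: 'a::t2_space topology)"
  unfolding Hausdorff_space_def disjnt_def using hausdorff by (metis open_openin)

lemma second_countable_euclidean:
  "second_countable (euclidean :: 'a::second_countable_topology topology)"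
proof -
  obtain \<B> :: "'a set set" where "countable \<B>" "topological_basis \<B>"
    using ex_countable_basis by blast
  then show ?thesis
    unfolding second_countable_def
    by (metis open_openin topological_basisE topological_basis_open)
qed

lemma second_countable_prod_topology:
  assumes "second_countable X" "second_countable Y"
  shows "second_countable (prod_topology X Y)"
proof -
  obtain \<B> \<C> where B: "countable \<B>" "\<forall>V \<in> \<B>. openin X V"
      "\<And>U x. openin X U \<Longrightarrow> x \<in> U \<Longrightarrow> \<exists>V \<in> \<B>. x \<in> V \<and> V \<subseteq> U"
    and C: "countable \<C>" "\<forall>V \<in> \<C>. openin Y V"
      "\<And>U x. openin Y U \<Longrightarrow> x \<in> U \<Longrightarrow> \<exists>V \<in> \<C>. x \<in> V \<and> V \<subseteq> U"
    using assms unfolding second_countable_def by metis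
  have "\<exists>V \<in> (\<lambda>(V, W). V \<times> W) ` (\<B> \<times> \<C>). z \<in> V \<and> V \<subseteq> U"
    if "openin (prod_topology X Y) U" "z \<in> U" for U z
  proof -
    obtain x y where z: "z = (x, y)" by fastforce
    have "\<exists>V W. openin X V \<and> openin Y W \<and> x \<in> V \<and> y \<in> W \<and> V \<times> W \<subseteq> U"
      using that z unfolding openin_prod_topology_alt by blast
    then obtain V W where VW: "openin X V" "openin Y W" "x \<in> V" "y \<in> W" "V \<times> W \<subseteq> U"
      by blast
    obtain V' W' where "V' \<in> \<B>" "x \<in> V'" "V' \<subseteq> V" "W' \<in> \<C>" "y \<in> W'" "W' \<subseteq> W"
      using B(3)[OF VW(1,3)] C(3)[OF VW(2,4)] by blast
    then show ?thesis using VW(5) z by (intro bexI[of _ "V' \<times> W'"]) auto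
  qed
  moreover have "openin (prod_topology X Y) V" if "V \<in> (\<lambda>(V, W). V \<times> W) ` (\<B> \<times> \<C>)" for V
    using that B(2) C(2) by (auto simp: openin_prod_Times_iff)
  ultimately show ?thesis
    unfolding second_countable_def using B(1) C(1)
    by (intro exI[of _ "(\<lambda>(V, W). V \<times> W) ` (\<B> \<times> \<C>)"]) auto
qed

section \<open>Neighbourhoods of zero and open homomorphisms\<close>

text \<open>Continuity of subtraction at \<open>(0, 0)\<close>; intersecting the two sides of a box
  makes one \<open>V\<close> serve for both arguments. It controls differences of points in a
  compact neighbourhood in the Baire argument, and differences within a fibre when the kernel is
  discrete.\<close>

lemma open_difference_nbhd:
  fixes W :: "'b::topological_group_add set"
  assumes "open W" "0 \<in> W"
  obtains V where "open V" "0 \<in> V" "\<And>x y. x \<in> V \<Longrightarrow> y \<in> V \<Longrightarrow> x - y \<in> W"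
proof -
  have "continuous_on UNIV (\<lambda>z::'b \<times> 'b. fst z - snd z)"
    unfolding diff_conv_add_uminus by (intro continuous_on_add continuous_on_minus continuous_on_fst continuous_on_snd continuous_on_id)
  then have "open ((\<lambda>z. fst z - snd z) -` W)" by (rule open_vimage[OF assms(1)])
  then have "\<exists>A B. open A \<and> open B \<and> (0, 0) \<in> A \<times> B \<and> A \<times> B \<subseteq> (\<lambda>z. fst z - snd z) -` W"
    using assms(2) unfolding open_prod_def by (elim ballE[of _ _ "(0, 0)"]) simp_all
  then obtain A B where AB: "open A" "open B" "(0, 0) \<in> A \<times> B" "A \<times> B \<subseteq> (\<lambda>z. fst z - snd z) -` W"
    by blast
  show thesis
  proof (rule that)
    show "open (A \<inter> B)" "0 \<in> A \<inter> B" using AB by auto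
    show "x - y \<in> W" if "x \<in> A \<inter> B" "y \<in> A \<inter> B" for x y
      using AB(4) that by force
  qed
qed

lemma open_translation:
  fixes W :: "'b::topological_group_add set"
  assumes "open W"
  shows "open {x. x - a \<in> W}"
proof -
  have "open ((\<lambda>x. x + - a) -` W)"
    by (rule open_vimage[OF assms]) (intro continuous_on_add continuous_on_id continuous_on_const)
  then show ?thesis by (simp add: vimage_def)
qed

lemma locally_compact_compact_nbhd:
  fixes W :: "'b::t2_space set"
  assumes "locally_compact_space (euclidean :: 'b topology)" "open W" "x \<in> W"
  obtains N K where "open N" "compact K" "x \<in> N" "N \<subseteq> K" "K \<subseteq> W"
proof -
  have "neighbourhood_base_of (compactin euclidean) (euclidean :: 'b topology)"
    using assms(1) Hausdorff_space_euclidean_t2 locally_compact_space_neighbourhood_base by blast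
  then show thesis
    using assms(2,3) that unfolding neighbourhood_base_of by (simp flip: open_openin) blast
qed

text \<open>Every \<open>x\<close> lies in its own translate of \<open>N\<close>, so all translates
  form an open cover, and the Lindelof property extracts a countable one.\<close>

lemma countable_translates_cover:
  fixes N :: "'b::{topological_group_add, second_countable_topology} set"
  assumes "open N" "0 \<in> N"
  obtains D where "countable D" "\<And>x. \<exists>d \<in> D. x - d \<in> N"
proof -
  let ?F = "range (\<lambda>d. {x. x - d \<in> N})"
  obtain F' where F': "F' \<subseteq> ?F" "countable F'" "\<Union>F' = \<Union>?F"
    using Lindelof[of ?F] open_translation[OF assms(1)] by auto
  then obtain D where D: "countable D" "F' = (\<lambda>d. {x. x - d \<in> N}) ` D"
    by (metis countable_subset_image)
  have "\<exists>d \<in> D. x - d \<in> N" for x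
  proof -
    have "x \<in> \<Union>?F" using assms(2) by (auto intro: exI[of _ x])
    then show ?thesis using F'(3) D(2) by auto
  qed
  then show thesis using D(1) that by blast
qed

text \<open>Countably many translates of a compact
  neighbourhood \<open>K\<close> of \<open>0\<close> cover \<open>B\<close>, so by Baire's theorem some translate of \<open>p ` K\<close>, and hence
  \<open>p ` K\<close> itself, has interior points.\<close>

lemma open_map_of_surj_hom:
  fixes p :: "'b::{topological_ab_group_add, t2_space, second_countable_topology} \<Rightarrow>
              'c::{topological_ab_group_add, t2_space}"
  assumes B: "locally_compact_space (euclidean :: 'b topology)"
    and C: "locally_compact_space (euclidean :: 'c topology)"
    and cont: "continuous_on UNIV p" and "Modules.additive p" and "surj p" and "open S"
  shows "open (p ` S)"
proof -
  interpret Modules.additive p by fact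
  have image_nbhd: "\<exists>V. open V \<and> 0 \<in> V \<and> V \<subseteq> p ` W" if W: "open W" "0 \<in> W" for W
  proof -
    \<comment> \<open>Baire only yields an interior point of some translate of the image of
      \<open>K\<close>. Subtracting two points of \<open>K\<close> will move it to 0, hence the
      demand that differences from \<open>W'\<close> stay in \<open>W\<close>.\<close>
    obtain W' where W': "open W'" "0 \<in> W'" "\<And>x y. x \<in> W' \<Longrightarrow> y \<in> W' \<Longrightarrow> x - y \<in> W"
      using open_difference_nbhd[OF W] by blast
    obtain N K where NK: "open N" "compact K" "0 \<in> N" "N \<subseteq> K" "K \<subseteq> W'"
      using locally_compact_compact_nbhd[OF B W'(1,2)] .
    obtain D where D: "countable D" "\<And>x. \<exists>d \<in> D. x - d \<in> N"
      using countable_translates_cover[OF NK(1,3)] by blast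
    \<comment> \<open>These sets are compact, hence closed in the Hausdorff target, as Baire's
      theorem requires.\<close>
    define T where "T d = (\<lambda>x. p d + p x) ` K" for d
    have "closed (T d)" for d
    proof -
      have "continuous_on K (\<lambda>x. p d + p x)"
        using cont by (intro continuous_on_add continuous_on_const) (rule continuous_on_subset, auto)
      then show ?thesis
        unfolding T_def using NK(2) by (intro compact_imp_closed compact_continuous_image)
    qed
    moreover have "\<Union>(T ` D) = UNIV"
    proof -
      have "y \<in> \<Union>(T ` D)" for y
      proof -
        obtain x where x: "y = p x" using \<open>surj p\<close> by blast
        obtain d where "d \<in> D" "x - d \<in> N" using D(2) by blast
        moreover have "y = p d + p (x - d)" using x by (simp add: diff)
        ultimately show ?thesis unfolding T_def using NK(4) by blast
      qed
      then show ?thesis by blast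
    qed
    moreover have "regular_space (euclidean :: 'c topology)"
      using C Hausdorff_space_euclidean_t2 locally_compact_Hausdorff_imp_regular_space by blast
    moreover have "euclidean interior_of (UNIV :: 'c set) = UNIV"
      using interior_of_topspace[of "euclidean :: 'c topology"] by simp
    \<comment> \<open>Otherwise the union of the countably many \<open>T d\<close> would have empty
      interior, but it is the whole space.\<close>
    ultimately have "\<exists>d \<in> D. euclidean interior_of T d \<noteq> {}"
      using Baire_category_alt[of "euclidean :: 'c topology" "T ` D"] C D(1)
      by (fastforce simp flip: closed_closedin)
    then obtain d t where t: "t \<in> euclidean interior_of T d"
      by blast
    define O' where "O' = euclidean interior_of T d"
    have O': "open O'" "O' \<subseteq> T d" "t \<in> O'"
      using t openin_interior_of[of euclidean "T d"] interior_of_subset[of euclidean "T d"]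
      by (simp_all add: O'_def flip: open_openin)
    \<comment> \<open>The neighbourhood of 0 is \<open>O'\<close> shifted by \<open>- t\<close>. For
      \<open>c\<close> in it, both \<open>c + t\<close> and \<open>t\<close> lie in the same
      \<open>T d\<close>, so \<open>p d\<close> cancels in their difference.\<close>
    show ?thesis
    proof (intro exI conjI subsetI)
      show "open {c. c - (- t) \<in> O'}" by (rule open_translation[OF O'(1)])
      show "0 \<in> {c. c - (- t) \<in> O'}" using O'(3) by simp
      fix c assume "c \<in> {c. c - (- t) \<in> O'}"
      then have "c + t \<in> T d" "t \<in> T d" using O' by auto
      then obtain x y where "x \<in> K" "y \<in> K" "c + t = p d + p x" "t = p d + p y"
        unfolding T_def by auto
      then have "x - y \<in> W" "c = p (x - y)"
        using W'(3) NK(5) by (auto simp: diff algebra_simps)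
      then show "c \<in> p ` W" by blast
    qed
  qed
  \<comment> \<open>Passage to an arbitrary point: shifting \<open>S\<close> by \<open>- s\<close>
    moves \<open>s\<close> to 0, and additivity carries the neighbourhood of 0 back to
    \<open>p s\<close>.\<close>
  have "\<exists>T. open T \<and> y \<in> T \<and> T \<subseteq> p ` S" if y: "y \<in> p ` S" for y
  proof -
    obtain s where s: "y = p s" "s \<in> S" using y by blast
    have "open {w. w - (- s) \<in> S}" by (rule open_translation[OF \<open>open S\<close>])
    then obtain V where V: "open V" "0 \<in> V" "V \<subseteq> p ` {w. w - (- s) \<in> S}"
      using image_nbhd[of "{w. w - (- s) \<in> S}"] s(2) by auto
    have "c \<in> p ` S" if "c - y \<in> V" for c
    proof -
      obtain w where "c - y = p w" "w + s \<in> S"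
        using subsetD[OF V(3) \<open>c - y \<in> V\<close>] by auto
      then show ?thesis using s(1) by (metis add diff_add_cancel image_eqI)
    qed
    moreover have "open {c. c - y \<in> V}" by (rule open_translation[OF V(1)])
    ultimately show ?thesis using V(2) by (intro exI[of _ "{c. c - y \<in> V}"]) auto
  qed
  then show ?thesis by (subst open_subopen) blast
qed

section \<open>Local homeomorphisms\<close>

text \<open>An injective restriction of a continuous open map to an open set is a homeomorphism onto
  its open image. Later proofs thus only have to establish local injectivity.\<close>

lemma local_homeomorphismI:
  assumes cont: "continuous_map X Y f" and opn: "open_map X Y f"
    and inj: "\<And>x. x \<in> topspace X \<Longrightarrow> \<exists>U. openin X U \<and> x \<in> U \<and> inj_on f U"
  shows "local_homeomorphism X Y f"
  unfolding local_homeomorphism_def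
proof (intro conjI ballI)
  show "f ` topspace X \<subseteq> topspace Y" by (rule continuous_map_image_subset_topspace[OF cont])
  fix x assume "x \<in> topspace X"
  then obtain U where U: "openin X U" "x \<in> U" "inj_on f U" using inj by blast
  then have fU: "openin Y (f ` U)" using opn by (simp add: open_map_def)
  have sub: "U \<subseteq> topspace X" "f ` U \<subseteq> topspace Y" using U(1) fU by (simp_all add: openin_subset)
  have "homeomorphic_map (subtopology X U) (subtopology Y (f ` U)) f"
  proof (rule bijective_open_imp_homeomorphic_map)
    show "continuous_map (subtopology X U) (subtopology Y (f ` U)) f"
      using cont by (auto simp: continuous_map_in_subtopology continuous_map_from_subtopology)
    show "open_map (subtopology X U) (subtopology Y (f ` U)) f"
      using opn U(1) fU by (auto simp: open_map_def openin_open_subtopology image_mono)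
    show "f ` topspace (subtopology X U) = topspace (subtopology Y (f ` U))"
      using sub by (auto simp: inf_absorb2)
    show "inj_on f (topspace (subtopology X U))" using U(3) sub by (simp add: inf_absorb2)
  qed
  then show "\<exists>U. openin X U \<and> x \<in> U \<and> openin Y (f ` U) \<and>
      homeomorphic_map (subtopology X U) (subtopology Y (f ` U)) f"
    using U fU by blast
qed

text \<open>Since the image of \<open>U\<close> is open in \<open>Y\<close>, the restriction is open
  into all of \<open>Y\<close> and not merely onto its image. In this form the local pieces can be
  glued.\<close>

lemma local_homeomorphismE:
  assumes "local_homeomorphism X Y f" "x \<in> topspace X"
  obtains U where "openin X U" "x \<in> U" "openin Y (f ` U)" "inj_on f U"
    "continuous_map (subtopology X U) Y f" "open_map (subtopology X U) Y f"
proof -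
  obtain U where U: "openin X U" "x \<in> U" "openin Y (f ` U)"
      "homeomorphic_map (subtopology X U) (subtopology Y (f ` U)) f"
    using assms unfolding local_homeomorphism_def by blast
  have "U \<subseteq> topspace X" using U(1) by (rule openin_subset)
  then have "inj_on f U"
    using homeomorphic_imp_injective_map[OF U(4)] by (simp add: inf_absorb2)
  moreover have "continuous_map (subtopology X U) Y f"
    using homeomorphic_imp_continuous_map[OF U(4)] continuous_map_in_subtopology by blast
  moreover have "open_map (subtopology X U) Y f"
    using homeomorphic_imp_open_map[OF U(4)] U(3)
    unfolding open_map_def by (blast intro: openin_trans_full)
  ultimately show thesis using that U by blast
qed

lemma local_homeomorphism_imp_continuous_map:
  assumes "local_homeomorphism X Y f"
  shows "continuous_map X Y f"
  unfolding continuous_map_def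
proof (intro conjI allI impI)
  show "f \<in> topspace X \<rightarrow> topspace Y" using assms by (auto simp: local_homeomorphism_def)
  fix V assume V: "openin Y V"
  show "openin X {x \<in> topspace X. f x \<in> V}"
  proof (rule iffD2[OF openin_subopen], intro ballI)
    fix x assume x: "x \<in> {x \<in> topspace X. f x \<in> V}"
    then obtain U where U: "openin X U" "x \<in> U" "continuous_map (subtopology X U) Y f"
      using local_homeomorphismE[OF assms, of x] by blast
    have "openin (subtopology X U) {x \<in> topspace (subtopology X U). f x \<in> V}"
      using U(3) V by (rule openin_continuous_map_preimage)
    then have "openin X {x \<in> topspace (subtopology X U). f x \<in> V}"
      using U(1) by (rule openin_trans_full)
    then show "\<exists>T. openin X T \<and> x \<in> T \<and> T \<subseteq> {x \<in> topspace X. f x \<in> V}"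
      using x U(2) by (intro exI[of _ "{x \<in> topspace (subtopology X U). f x \<in> V}"]) auto
  qed
qed

lemma local_homeomorphism_imp_open_map:
  assumes "local_homeomorphism X Y f"
  shows "open_map X Y f"
  unfolding open_map_def
proof (intro allI impI)
  fix W assume W: "openin X W"
  show "openin Y (f ` W)"
  proof (rule iffD2[OF openin_subopen], intro ballI)
    fix y assume "y \<in> f ` W"
    then obtain x where x: "x \<in> W" "y = f x" by blast
    then have "x \<in> topspace X" using W openin_subset by blast
    then obtain U where U: "openin X U" "x \<in> U" "open_map (subtopology X U) Y f"
      using local_homeomorphismE[OF assms, of x] by blast
    have "openin (subtopology X U) (W \<inter> U)" using W by (auto simp: openin_subtopology)
    then have "openin Y (f ` (W \<inter> U))" using U(3) by (simp add: open_map_def)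
    then show "\<exists>T. openin Y T \<and> y \<in> T \<and> T \<subseteq> f ` W" using x U(2) by blast
  qed
qed

lemma local_homeomorphism_compose:
  assumes f: "local_homeomorphism X Y f" and g: "local_homeomorphism Y Z g"
  shows "local_homeomorphism X Z (g \<circ> f)"
proof (rule local_homeomorphismI)
  have cf: "continuous_map X Y f" by (rule local_homeomorphism_imp_continuous_map[OF f])
  then show "continuous_map X Z (g \<circ> f)"
    using local_homeomorphism_imp_continuous_map[OF g] continuous_map_compose by blast
  show "open_map X Z (g \<circ> f)"
    by (rule open_map_compose[OF local_homeomorphism_imp_open_map[OF f]
          local_homeomorphism_imp_open_map[OF g]])
  fix x assume x: "x \<in> topspace X"
  obtain U where U: "openin X U" "x \<in> U" "inj_on f U"
    using local_homeomorphismE[OF f x] by blast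
  have "f x \<in> topspace Y" using cf x by (auto simp: continuous_map_def)
  then obtain V where V: "openin Y V" "f x \<in> V" "inj_on g V"
    using local_homeomorphismE[OF g, of "f x"] by blast
  have "openin X (U \<inter> {x \<in> topspace X. f x \<in> V})"
    using U(1) openin_continuous_map_preimage[OF cf V(1)] by blast
  moreover have "inj_on (g \<circ> f) (U \<inter> {x \<in> topspace X. f x \<in> V})"
    using U(3) V(3) by (auto simp: inj_on_def)
  ultimately show "\<exists>U. openin X U \<and> x \<in> U \<and> inj_on (g \<circ> f) U"
    using x U(2) V(2) by (intro exI[of _ "U \<inter> {x \<in> topspace X. f x \<in> V}"]) auto
qed

lemma homeomorphic_map_imp_local_homeomorphism:
  assumes "homeomorphic_map X Y f"
  shows "local_homeomorphism X Y f"
  using assms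
  by (intro local_homeomorphismI) (auto simp: homeomorphic_eq_everything_map)

section \<open>Subgroupoids and products of topological groupoids\<close>

lemma composable_iff:
  "(x, y) \<in> composable G \<longleftrightarrow> x \<in> arrows G \<and> y \<in> arrows G \<and> gsrc G x = grng G y"
  by (simp add: composable_def)

context groupoid
begin

lemma units_subset: "units G \<subseteq> arrows G"
  unfolding units_def using src_closed by auto

lemma unit_src: "u \<in> units G \<Longrightarrow> gsrc G u = u"
  unfolding units_def using src_src by auto

lemma unit_rng: "u \<in> units G \<Longrightarrow> grng G u = u"
  unfolding units_def using rng_src by auto

lemma src_in_units: "x \<in> arrows G \<Longrightarrow> gsrc G x \<in> units G"
  by (simp add: units_def)

lemma rng_in_units: "x \<in> arrows G \<Longrightarrow> grng G x \<in> units G"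
  unfolding units_def using src_rng rng_closed by (metis image_eqI)

lemma unit_mul_unit: "u \<in> units G \<Longrightarrow> gmul G u u = u"
  using rng_mul_left units_subset unit_rng by (metis subsetD)

lemma unit_composable: "u \<in> units G \<Longrightarrow> (u, u) \<in> composable G"
  using units_subset unit_src unit_rng by (auto simp: composable_iff)

lemma inv_composable: "x \<in> arrows G \<Longrightarrow> (ginv G x, x) \<in> composable G"
  using inv_closed src_inv by (simp add: composable_iff)

lemma rng_composable: "x \<in> arrows G \<Longrightarrow> (grng G x, x) \<in> composable G"
  using rng_closed src_rng by (simp add: composable_iff)

text \<open>The definition of \<open>subgroupoid\<close> mentions only inverses and products;
  sources are recovered as the product of the inverse of \<open>x\<close> with
  \<open>x\<close>.\<close>

lemma subgroupoid_src:
  assumes "subgroupoid S G" "x \<in> S"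
  shows "gsrc G x \<in> S"
proof -
  have "x \<in> arrows G" "ginv G x \<in> S" using assms by (auto simp: subgroupoid_def)
  then have "gmul G (ginv G x) x \<in> S"
    using assms inv_composable unfolding subgroupoid_def by blast
  then show ?thesis using \<open>x \<in> arrows G\<close> mul_inv_left by simp
qed

lemma subgroupoid_rng:
  assumes "subgroupoid S G" "x \<in> S"
  shows "grng G x \<in> S"
proof -
  have "x \<in> arrows G" "ginv G x \<in> S" using assms by (auto simp: subgroupoid_def)
  then show ?thesis using subgroupoid_src[OF assms(1), of "ginv G x"] src_inv by simp
qed

end

lemma restrict_groupoid_sel [simp]:
  "gtop (restrict_groupoid G S) = subtopology (gtop G) S"
  "gmul (restrict_groupoid G S) = gmul G"
  "ginv (restrict_groupoid G S) = ginv G"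
  "gsrc (restrict_groupoid G S) = gsrc G"
  "grng (restrict_groupoid G S) = grng G"
  by (simp_all add: restrict_groupoid_def)

lemma prod_groupoid_sel [simp]:
  "gtop (prod_groupoid G A) = prod_topology (gtop G) (top_of_set A)"
  "gmul (prod_groupoid G A) = (\<lambda>(x, a) (y, b). (gmul G x y, a + b))"
  "ginv (prod_groupoid G A) = (\<lambda>(x, a). (ginv G x, - a))"
  "gsrc (prod_groupoid G A) = (\<lambda>(x, a). (gsrc G x, 0))"
  "grng (prod_groupoid G A) = (\<lambda>(x, a). (grng G x, 0))"
  by (simp_all add: prod_groupoid_def)

context topological_groupoid
begin

text \<open>The axiom \<open>continuous_mul\<close> speaks about the subspace of composable pairs.
  Here it is turned into a rule for pointwise products, with composability as a side
  condition.\<close>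

lemma continuous_map_gmul:
  assumes "continuous_map X (gtop G) f" "continuous_map X (gtop G) g"
    and "\<And>x. x \<in> topspace X \<Longrightarrow> (f x, g x) \<in> composable G"
  shows "continuous_map X (gtop G) (\<lambda>x. gmul G (f x) (g x))"
proof -
  have "continuous_map X (subtopology (prod_topology (gtop G) (gtop G)) (composable G))
      (\<lambda>x. (f x, g x))"
    using assms by (auto simp: continuous_map_in_subtopology intro: continuous_map_pairedI)
  from continuous_map_compose[OF this continuous_mul] show ?thesis
    by (simp add: comp_def)
qed

lemma topological_groupoid_restrict:
  assumes S: "subgroupoid S G"
  shows "topological_groupoid (restrict_groupoid G S)"
proof -
  have S_arrows: "arrows (restrict_groupoid G S) = S"
    using S by (auto simp: subgroupoid_def)
  have S_G: "x \<in> S \<Longrightarrow> x \<in> arrows G" for x using S by (auto simp: subgroupoid_def)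
  have comp: "(x, y) \<in> composable (restrict_groupoid G S) \<longleftrightarrow>
      x \<in> S \<and> y \<in> S \<and> (x, y) \<in> composable G" for x y
    using S_G by (auto simp: composable_iff)
  show ?thesis
  proof
    show "gmul (restrict_groupoid G S) x y \<in> arrows (restrict_groupoid G S)"
      if "(x, y) \<in> composable (restrict_groupoid G S)" for x y
      using that S unfolding S_arrows comp by (auto simp: subgroupoid_def)
    let ?X = "subtopology (prod_topology (gtop (restrict_groupoid G S)) (gtop (restrict_groupoid G S)))
      (composable (restrict_groupoid G S))"
    have top: "topspace ?X = composable (restrict_groupoid G S)"
      by (auto simp: composable_def)
    have "continuous_map ?X (gtop G) (\<lambda>z. gmul G (fst z) (snd z))"
    proof (rule continuous_map_gmul)
      show "continuous_map ?X (gtop G) fst" "continuous_map ?X (gtop G) snd"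
        using continuous_map_fst[of "subtopology (gtop G) S" "subtopology (gtop G) S"]
          continuous_map_snd[of "subtopology (gtop G) S" "subtopology (gtop G) S"]
        by (auto simp: continuous_map_in_subtopology intro: continuous_map_from_subtopology)
      show "(fst z, snd z) \<in> composable G" if "z \<in> topspace ?X" for z
        using that comp unfolding top by (metis prod.collapse)
    qed
    moreover have "gmul G (fst z) (snd z) \<in> S" if "z \<in> topspace ?X" for z
      using that comp S unfolding top subgroupoid_def by (metis prod.collapse)
    ultimately show "continuous_map ?X (gtop (restrict_groupoid G S))
        (\<lambda>(x, y). gmul (restrict_groupoid G S) x y)"
      by (auto simp: continuous_map_in_subtopology case_prod_unfold)
    show "continuous_map (gtop (restrict_groupoid G S)) (gtop (restrict_groupoid G S))
        (ginv (restrict_groupoid G S))"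
      using continuous_inv S
      by (auto simp: continuous_map_in_subtopology continuous_map_from_subtopology subgroupoid_def)
  qed (use S S_G subgroupoid_src[OF S] subgroupoid_rng[OF S] in
      \<open>unfold S_arrows comp restrict_groupoid_sel,
       auto simp: subgroupoid_def src_src rng_src src_rng rng_rng src_mul rng_mul mul_assoc
         rng_mul_left mul_src_right src_inv rng_inv mul_inv_right mul_inv_left\<close>)
qed

lemma topological_groupoid_prod:
  fixes A :: "'b::topological_ab_group_add set"
  assumes A: "additive_subgroup A"
  shows "topological_groupoid (prod_groupoid G A)"
proof -
  have A': "0 \<in> A" "\<And>a b. a \<in> A \<Longrightarrow> b \<in> A \<Longrightarrow> a + b \<in> A" "\<And>a. a \<in> A \<Longrightarrow> - a \<in> A"
    using A by (auto simp: additive_subgroup_def)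
  let ?P = "prod_groupoid G A"
  have comp: "(z, w) \<in> composable ?P \<longleftrightarrow>
      (fst z, fst w) \<in> composable G \<and> snd z \<in> A \<and> snd w \<in> A" for z w
    by (auto simp: composable_iff case_prod_unfold mem_Times_iff)
  show ?thesis
  proof
    let ?X = "subtopology (prod_topology (gtop ?P) (gtop ?P)) (composable ?P)"
    have top: "topspace ?X = composable ?P"
      by (auto simp: composable_def)
    have fs: "continuous_map ?X (gtop ?P) fst" "continuous_map ?X (gtop ?P) snd"
      by (auto intro: continuous_map_from_subtopology continuous_map_fst continuous_map_snd)
    have 1: "continuous_map ?X (gtop G) (\<lambda>z. gmul G (fst (fst z)) (fst (snd z)))"
    proof (rule continuous_map_gmul)
      show "continuous_map ?X (gtop G) (\<lambda>z. fst (fst z))" "continuous_map ?X (gtop G) (\<lambda>z. fst (snd z))"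
        using continuous_map_fst_of[OF fs(1)[simplified prod_groupoid_sel(1)]]
          continuous_map_fst_of[OF fs(2)[simplified prod_groupoid_sel(1)]]
        by (simp_all add: comp_def)
      show "(fst (fst z), fst (snd z)) \<in> composable G" if "z \<in> topspace ?X" for z
        using that comp[of "fst z" "snd z"] unfolding top by simp
    qed
    have sn: "continuous_map ?X euclidean (\<lambda>z. snd (fst z))"
             "continuous_map ?X euclidean (\<lambda>z. snd (snd z))"
      using continuous_map_snd_of[OF fs(1)[simplified prod_groupoid_sel(1)]]
        continuous_map_snd_of[OF fs(2)[simplified prod_groupoid_sel(1)]]
      by (simp_all add: comp_def continuous_map_in_subtopology)
    \<comment> \<open>The second factor carries the subspace topology of \<open>A\<close>:
      continuity is checked in the ambient group, and closure of \<open>A\<close> under addition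
      gives the corestriction.\<close>
    have 2: "continuous_map ?X (top_of_set A) (\<lambda>z. snd (fst z) + snd (snd z))"
      unfolding continuous_map_in_subtopology
    proof
      show "continuous_map ?X euclidean (\<lambda>z. snd (fst z) + snd (snd z))"
        by (rule continuous_map_group_add[OF sn])
      show "(\<lambda>z. snd (fst z) + snd (snd z)) \<in> topspace ?X \<rightarrow> A"
        unfolding top using comp A'(2) by (auto simp del: prod_groupoid_sel)
    qed
    show "continuous_map ?X (gtop ?P) (\<lambda>(x, y). gmul ?P x y)"
      using continuous_map_pairedI[OF 1 2] by (simp add: case_prod_unfold)
    have "continuous_map (gtop ?P) euclidean (\<lambda>z. - snd z)"
      using continuous_map_snd[of "gtop G" "top_of_set A"]
      by (intro continuous_map_group_minus) (simp add: continuous_map_in_subtopology)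
    then have "continuous_map (gtop ?P) (top_of_set A) (\<lambda>z. - snd z)"
      using A'(3) by (auto simp: continuous_map_in_subtopology)
    moreover have "continuous_map (gtop ?P) (gtop G) (\<lambda>z. ginv G (fst z))"
      using continuous_map_compose[OF continuous_map_fst continuous_inv] by (simp add: comp_def)
    ultimately show "continuous_map (gtop ?P) (gtop ?P) (ginv ?P)"
      by (simp add: case_prod_unfold continuous_map_pairedI)
  qed (use A' in \<open>auto simp: comp simp del: prod_groupoid_sel(1)\<close>; simp add: case_prod_unfold A' comp
     src_closed rng_closed inv_closed mul_closed src_src rng_src src_rng rng_rng src_mul rng_mul mul_assoc
     rng_mul_left mul_src_right src_inv rng_inv mul_inv_right mul_inv_left add.assoc)+
qed

end

text \<open>Closedness of \<open>S\<close> is what transfers local compactness; second countability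
  and the Hausdorff property pass to every subspace.\<close>

lemma (in lcsc_groupoid) lcsc_groupoid_restrict:
  assumes "subgroupoid S G" "closedin (gtop G) S"
  shows "lcsc_groupoid (restrict_groupoid G S)"
  unfolding lcsc_groupoid_def lcsc_groupoid_axioms_def
  using topological_groupoid_restrict[OF assms(1)] assms(2)
  by (simp add: second_countable second_countable_subtopology locally_compact
      locally_compact_space_closed_subset Hausdorff Hausdorff_space_subtopology)

lemma (in lcsc_groupoid) lcsc_groupoid_prod:
  fixes A :: "'b::{topological_ab_group_add, t2_space, second_countable_topology} set"
  assumes "additive_subgroup A" "locally_compact_space (top_of_set A)"
  shows "lcsc_groupoid (prod_groupoid G A)"
  unfolding lcsc_groupoid_def lcsc_groupoid_axioms_def
  using topological_groupoid_prod[OF assms(1)] assms(2)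
  by (simp add: second_countable second_countable_subtopology locally_compact
      second_countable_euclidean second_countable_prod_topology locally_compact_space_prod_topology
      Hausdorff_space_prod_topology Hausdorff Hausdorff_space_subtopology
      Hausdorff_space_euclidean_t2)

section \<open>The groupoid of a cocycle\<close>

lemma subgroup_hom_kernel:
  assumes "Modules.additive p"
  shows "additive_subgroup (hom_kernel p)"
proof -
  interpret Modules.additive p by fact
  show ?thesis by (simp add: additive_subgroup_def hom_kernel_def add zero minus)
qed

lemma arrows_Sigma_groupoid: "arrows (Sigma_groupoid G p \<phi>) = Sigma_set G p \<phi>"
  by (auto simp: Sigma_groupoid_def Sigma_set_def)

lemma Sigma_groupoid_sel:
  "gtop (Sigma_groupoid G p \<phi>) = subtopology (prod_topology (gtop G) euclidean) (Sigma_set G p \<phi>)"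
  "gmul (Sigma_groupoid G p \<phi>) = (\<lambda>(x, a) (y, b). (gmul G x y, a + b))"
  "ginv (Sigma_groupoid G p \<phi>) = (\<lambda>(x, a). (ginv G x, - a))"
  "gsrc (Sigma_groupoid G p \<phi>) = (\<lambda>(x, a). (gsrc G x, 0))"
  "grng (Sigma_groupoid G p \<phi>) = (\<lambda>(x, a). (grng G x, 0))"
  by (simp_all add: Sigma_groupoid_def)

lemma composable_Sigma_groupoid:
  "(z, w) \<in> composable (Sigma_groupoid G p \<phi>) \<longleftrightarrow>
    z \<in> Sigma_set G p \<phi> \<and> w \<in> Sigma_set G p \<phi> \<and> (fst z, fst w) \<in> composable G"
  by (auto simp: composable_iff arrows_Sigma_groupoid Sigma_groupoid_sel(4,5) Sigma_set_def)

text \<open>This is an equality of records, topology included, so everything proved for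
  \<open>Sigma_groupoid\<close> transfers to the trivial twist by rewriting.\<close>

lemma prod_groupoid_eq_Sigma_groupoid:
  fixes p :: "'b::topological_ab_group_add \<Rightarrow> 'c::zero"
  shows "prod_groupoid G (hom_kernel p) = Sigma_groupoid G p (\<lambda>x. 0)"
proof -
  have "Sigma_set G p (\<lambda>x. 0) = arrows G \<times> hom_kernel p"
    by (auto simp: Sigma_set_def hom_kernel_def)
  then show ?thesis
    by (simp add: Sigma_groupoid_def restrict_groupoid_def prod_groupoid_def prod_topology_subtopology)
qed

section \<open>The extension determined by a fixed cocycle\<close>

text \<open>The hypotheses form a locale because they are instantiated twice: with the given
  cocycle, and with the zero cocycle to obtain the trivial twist.\<close>

locale cocycle_extension = lcsc_groupoid G for G :: "'a tgroupoid" +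
  fixes p :: "'b::{topological_ab_group_add, t2_space, second_countable_topology} \<Rightarrow>
              'c::{topological_ab_group_add, t2_space, second_countable_topology}"
    and \<phi> :: "'a \<Rightarrow> 'c"
  assumes locally_compact_B: "locally_compact_space (euclidean :: 'b topology)"
    and locally_compact_C: "locally_compact_space (euclidean :: 'c topology)"
    and continuous_p: "continuous_on UNIV p"
    and additive_p: "Modules.additive p"
    and surj_p: "surj p"
    and cocycle: "continuous_cocycle G \<phi>"
begin

sublocale p: Modules.additive p
  by (rule additive_p)

abbreviation S :: "('a \<times> 'b) set"
  where "S \<equiv> Sigma_set G p \<phi>"

abbreviation E :: "('a \<times> 'b) tgroupoid"
  where "E \<equiv> Sigma_groupoid G p \<phi>"

abbreviation A :: "'b set"
  where "A \<equiv> hom_kernel p"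

lemma continuous_phi: "continuous_map (gtop G) euclidean \<phi>"
  using cocycle by (simp add: continuous_cocycle_def)

lemma cocycle_mul: "(x, y) \<in> composable G \<Longrightarrow> \<phi> (gmul G x y) = \<phi> x + \<phi> y"
  using cocycle by (auto simp: continuous_cocycle_def)

lemma cocycle_unit: "u \<in> units G \<Longrightarrow> \<phi> u = 0"
  using cocycle_mul[OF unit_composable] unit_mul_unit by simp

lemma cocycle_inv: "x \<in> arrows G \<Longrightarrow> \<phi> (ginv G x) = - \<phi> x"
  using cocycle_mul[OF inv_composable, of x] mul_inv_left[of x] cocycle_unit[OF src_in_units, of x]
  by (simp add: eq_neg_iff_add_eq_0)

lemma subgroup_A: "additive_subgroup A"
  by (rule subgroup_hom_kernel[OF additive_p])

lemma closed_A: "closed A"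
  unfolding hom_kernel_def
  using closed_Collect_eq[OF continuous_p continuous_on_const[of UNIV 0]] .

lemma subgroupoid_S: "subgroupoid S (prod_groupoid G UNIV)"
  unfolding subgroupoid_def
  by (auto simp: Sigma_set_def inv_closed cocycle_inv p.minus p.add composable_iff
      mul_closed cocycle_mul)

text \<open>The set is the equaliser of two continuous maps, \<open>\<phi>\<close> after
  \<open>fst\<close> and \<open>p\<close> after \<open>snd\<close>, into a Hausdorff space.\<close>

lemma closedin_S: "closedin (gtop (prod_groupoid G (UNIV :: 'b set))) S"
proof -
  let ?X = "prod_topology (gtop G) (euclidean :: 'b topology)"
  have "continuous_map ?X euclidean (\<lambda>z. \<phi> (fst z))"
    using continuous_map_compose[OF continuous_map_fst continuous_phi] by (simp add: comp_def)
  moreover have "continuous_map ?X euclidean (\<lambda>z. p (snd z))"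
    using continuous_map_compose[OF continuous_map_snd, of euclidean euclidean p "gtop G"] continuous_p
    by (simp add: comp_def)
  ultimately have "closedin ?X {z \<in> topspace ?X. \<phi> (fst z) = p (snd z)}"
    using closedin_continuous_maps_eq Hausdorff_space_euclidean_t2 by blast
  moreover have "{z \<in> topspace ?X. \<phi> (fst z) = p (snd z)} = S"
    by (auto simp: Sigma_set_def)
  ultimately show ?thesis by simp
qed

lemma lcsc_groupoid_E: "lcsc_groupoid E"
proof -
  interpret P: lcsc_groupoid "prod_groupoid G (UNIV :: 'b set)"
    using locally_compact_B by (intro lcsc_groupoid_prod) (simp_all add: additive_subgroup_def)
  show ?thesis
    unfolding Sigma_groupoid_def by (rule P.lcsc_groupoid_restrict[OF subgroupoid_S closedin_S])
qed

lemma fst_S: "fst ` S = arrows G"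
proof -
  have "x \<in> fst ` S" if "x \<in> arrows G" for x
  proof -
    obtain b where "\<phi> x = p b" using surj_p by blast
    then show ?thesis using that by (force simp: Sigma_set_def)
  qed
  then show ?thesis by (auto simp: Sigma_set_def)
qed

lemma groupoid_hom_projection: "groupoid_hom E G fst"
  unfolding groupoid_hom_def
  using fst_S
  by (auto simp: arrows_Sigma_groupoid composable_Sigma_groupoid Sigma_groupoid_sel(2)
      case_prod_unfold)

lemma continuous_projection: "continuous_map (gtop E) (gtop G) fst"
  by (simp add: Sigma_groupoid_sel continuous_map_from_subtopology continuous_map_fst)

lemma open_map_projection: "open_map (gtop E) (gtop G) fst"
  unfolding open_map_def
proof (intro allI impI)
  fix U assume "openin (gtop E) U"
  then obtain T where T: "openin (prod_topology (gtop G) (euclidean :: 'b topology)) T" "U = T \<inter> S"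
    by (auto simp: Sigma_groupoid_sel openin_subtopology)
  show "openin (gtop G) (fst ` U)"
  proof (rule iffD2[OF openin_subopen], intro ballI)
    fix x assume "x \<in> fst ` U"
    then obtain b where b: "(x, b) \<in> T" "x \<in> arrows G" "\<phi> x = p b"
      using T(2) by (auto simp: Sigma_set_def)
    then obtain V W where VW: "openin (gtop G) V" "open W" "x \<in> V" "b \<in> W" "V \<times> W \<subseteq> T"
      using T(1) unfolding openin_prod_topology_alt by (metis open_openin)
    \<comment> \<open>If \<open>y\<close> is in \<open>V\<close> and \<open>\<phi> y = p w\<close>
      with \<open>w\<close> in \<open>W\<close>, then \<open>(y, w)\<close> lies in the box and in
      \<open>S\<close>. So the projection covers this neighbourhood of \<open>x\<close>, which is
      open because \<open>p\<close> is an open map.\<close>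
    let ?N = "V \<inter> {y \<in> arrows G. \<phi> y \<in> p ` W}"
    have "open (p ` W)"
      by (rule open_map_of_surj_hom[OF locally_compact_B locally_compact_C continuous_p additive_p
            surj_p VW(2)])
    then have "openin (gtop G) ?N"
      using VW(1) openin_continuous_map_preimage[OF continuous_phi] by (simp add: openin_Int)
    moreover have "x \<in> ?N" using VW b by auto
    moreover have "?N \<subseteq> fst ` U" using VW(5) T(2) by (force simp: Sigma_set_def)
    ultimately show "\<exists>N. openin (gtop G) N \<and> x \<in> N \<and> N \<subseteq> fst ` U" by blast
  qed
qed

lemma units_E: "units E = units G \<times> {0}"
proof -
  have "units E = (\<lambda>z. (gsrc G (fst z), 0)) ` S"
    by (simp add: units_def arrows_Sigma_groupoid Sigma_groupoid_sel(4) case_prod_unfold)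
  also have "\<dots> = (\<lambda>x. (gsrc G x, 0)) ` fst ` S" by (simp add: image_image)
  also have "\<dots> = units G \<times> {0}" unfolding fst_S units_def by auto
  finally show ?thesis .
qed

text \<open>Cocycles vanish on units, so the condition \<open>\<phi> u = p b\<close> there reduces
  to \<open>b\<close> being in the kernel. This is exactness of the extension in the middle.\<close>

lemma fibre_over_units: "{z \<in> S. fst z \<in> units G} = units G \<times> A"
  using cocycle_unit units_subset by (auto simp: Sigma_set_def hom_kernel_def)

text \<open>Both sides are the subspace topology from the full product on the same set. Hence the
  inclusion \<open>j\<close>, which is the identity map, is a homeomorphism onto its image.\<close>

lemma topology_group_bundle:
  "gtop (group_bundle G A) = subtopology (gtop E) {z \<in> arrows E. fst z \<in> units G}"
proof -
  have "gtop (group_bundle G A) =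
      subtopology (prod_topology (gtop G) euclidean) ((arrows G \<times> A) \<inter> (units G \<times> A))"
    by (simp add: group_bundle_def prod_topology_subtopology subtopology_subtopology)
  also have "(arrows G \<times> A) \<inter> (units G \<times> A) = S \<inter> {z \<in> S. fst z \<in> units G}"
    using units_subset fibre_over_units by auto
  finally show ?thesis
    unfolding arrows_Sigma_groupoid by (simp only: Sigma_groupoid_sel(1) subtopology_subtopology)
qed

lemma twist_E: "twist G A E (\<lambda>(u, a). (u, a)) fst"
proof -
  have id: "(\<lambda>(u, a). (u, a)) = (id :: 'a \<times> 'b \<Rightarrow> _)" by auto
  have ops: "gmul (group_bundle G A) = gmul E" "gsrc (group_bundle G A) = gsrc E"
      "grng (group_bundle G A) = grng E"
    by (simp_all add: group_bundle_def Sigma_groupoid_sel)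
  have "arrows (group_bundle G A) \<subseteq> arrows E"
    unfolding topology_group_bundle by auto
  then have "groupoid_hom (group_bundle G A) E id"
    unfolding groupoid_hom_def composable_def ops by auto
  moreover have "locally_compact_space (top_of_set A)"
    using locally_compact_space_closed_subset[OF locally_compact_B] closed_A by simp
  moreover have "Hausdorff_space (top_of_set A)"
    by (simp add: Hausdorff_space_subtopology Hausdorff_space_euclidean_t2)
  moreover have "homeomorphic_map (gtop (group_bundle G A))
      (subtopology (gtop E) {x \<in> arrows E. fst x \<in> units G}) id"
    by (simp only: homeomorphic_map_id topology_group_bundle)
  \<comment> \<open>Centrality: units act trivially on the first coordinate, and in the second it is
    commutativity of addition.\<close>
  moreover have "gmul E (fst (grng E x), a) x = gmul E x (fst (gsrc E x), a)" if "x \<in> arrows E" for x a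
    using that rng_mul_left mul_src_right
    by (auto simp: arrows_Sigma_groupoid Sigma_groupoid_sel(2,4,5) Sigma_set_def add.commute)
  ultimately show ?thesis
    unfolding twist_def id
    using lcsc_groupoid_axioms lcsc_groupoid_E subgroup_A groupoid_hom_projection continuous_projection open_map_projection
      fst_S units_E
    by (auto simp: arrows_Sigma_groupoid)
qed

lemma continuous_cocycle_zero: "continuous_cocycle G (\<lambda>x. 0)"
  by (auto simp: continuous_cocycle_def)

lemma twist_trivial: "twist G A (prod_groupoid G A) (\<lambda>(u, a). (u, a)) fst"
proof -
  interpret trivial: cocycle_extension G p "\<lambda>x. 0"
    by unfold_locales (simp_all add: locally_compact_B locally_compact_C continuous_p surj_p
        continuous_cocycle_zero)
  show ?thesis
    unfolding prod_groupoid_eq_Sigma_groupoid by (rule trivial.twist_E)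
qed

section \<open>Lifts of the cocycle and trivialisations\<close>

text \<open>Given \<open>f (x, b) = (x, g (x, b))\<close>, the difference \<open>b - g (x, b)\<close> depends on \<open>x\<close> only, because
  \<open>(x, b') = (r x, b' - b) (x, b)\<close> and \<open>f\<close> fixes \<open>(r x, b' - b)\<close>.  It is continuous in \<open>x\<close> since \<open>fst\<close>
  is a quotient map.\<close>

lemma lift_of_proper_isomorphism:
  assumes hom: "groupoid_hom E (prod_groupoid G A) f"
    and cont: "continuous_map (gtop E) (gtop (prod_groupoid G A)) f"
    and proj: "\<And>z. z \<in> S \<Longrightarrow> fst (f z) = fst z"
    and incl: "\<And>u a. u \<in> units G \<Longrightarrow> a \<in> A \<Longrightarrow> f (u, a) = (u, a)"
  shows "\<exists>\<psi> :: 'a \<Rightarrow> 'b. continuous_cocycle G \<psi> \<and> (\<forall>x \<in> arrows G. \<phi> x = p (\<psi> x))"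
proof -
  define g where "g z = snd (f z)" for z
  have g_A: "p (g z) = 0" if "z \<in> S" for z
    using that hom unfolding groupoid_hom_def g_def
    by (auto simp: arrows_Sigma_groupoid hom_kernel_def)
  have g_mul: "g (gmul G x y, b + c) = g (x, b) + g (y, c)"
    if "(x, b) \<in> S" "(y, c) \<in> S" "(x, y) \<in> composable G" for x y b c
  proof -
    have "((x, b), (y, c)) \<in> composable E" using that by (simp add: composable_Sigma_groupoid)
    then have "f (gmul E (x, b) (y, c)) = gmul (prod_groupoid G A) (f (x, b)) (f (y, c))"
      using hom unfolding groupoid_hom_def by blast
    then show ?thesis by (simp add: g_def Sigma_groupoid_sel(2) case_prod_unfold)
  qed
  have indep: "b' - g (x, b') = b - g (x, b)" if "(x, b) \<in> S" "(x, b') \<in> S" for x b b'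
  proof -
    have x: "x \<in> arrows G" using that by (simp add: Sigma_set_def)
    have A: "b' - b \<in> A" using that by (simp add: Sigma_set_def hom_kernel_def p.diff)
    have "(grng G x, b' - b) \<in> S" using rng_in_units[OF x] A fibre_over_units by blast
    then have "g (gmul G (grng G x) x, b' - b + b) = g (grng G x, b' - b) + g (x, b)"
      using g_mul that(1) rng_composable[OF x] by blast
    then have "g (x, b') = b' - b + g (x, b)"
      using incl[OF rng_in_units[OF x] A] rng_mul_left[OF x] by (simp add: g_def)
    then show ?thesis by simp
  qed
  \<comment> \<open>The choice of \<open>b\<close> is harmless by \<open>indep\<close>. Outside the
    arrows no such \<open>b\<close> exists and the value is arbitrary, which no later condition
    sees.\<close>
  define \<psi> where "\<psi> x = (SOME b. (x, b) \<in> S) - g (x, SOME b. (x, b) \<in> S)" for x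
  have psi: "\<psi> x = b - g (x, b)" if "(x, b) \<in> S" for x b
    unfolding \<psi>_def by (rule indep[OF that someI[of "\<lambda>b. (x, b) \<in> S", OF that]])
  have lift: "\<exists>b. (x, b) \<in> S" if "x \<in> arrows G" for x
    using that fst_S by force
  have "continuous_map (gtop G) euclidean \<psi>"
  proof (rule continuous_compose_quotient_map)
    show "quotient_map (gtop E) (gtop G) fst"
      using continuous_open_quotient_map[OF continuous_projection open_map_projection] fst_S
      by (simp add: arrows_Sigma_groupoid)
    have "continuous_map (gtop E) euclidean g"
      using continuous_map_snd_of[OF cont[unfolded prod_groupoid_sel]]
      by (simp add: g_def[abs_def] comp_def continuous_map_in_subtopology)
    moreover have "continuous_map (gtop E) euclidean snd"
      by (simp add: Sigma_groupoid_sel continuous_map_from_subtopology continuous_map_snd)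
    ultimately have "continuous_map (gtop E) euclidean (\<lambda>z. snd z - g z)"
      by (intro continuous_map_group_diff)
    then show "continuous_map (gtop E) euclidean (\<psi> \<circ> fst)"
      by (rule continuous_map_eq) (auto simp: arrows_Sigma_groupoid psi)
  qed
  moreover have "\<psi> (gmul G x y) = \<psi> x + \<psi> y" if xy: "(x, y) \<in> composable G" for x y
  proof -
    obtain b c where bc: "(x, b) \<in> S" "(y, c) \<in> S"
      using lift xy by (metis composable_iff)
    \<comment> \<open>The product of the two chosen points is an admissible point over the product
      arrow, so \<open>\<psi>\<close> may be evaluated there, where \<open>g\<close> is
      additive.\<close>
    then have "(gmul G x y, b + c) \<in> S"
      using mul_closed[OF xy] cocycle_mul[OF xy] by (simp add: Sigma_set_def p.add)
    then show ?thesis using psi bc g_mul[OF bc xy] by simp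
  qed
  \<comment> \<open>The correction \<open>g (x, b)\<close> lies in the kernel, since
    \<open>f\<close> takes values in the trivial twist; subtracting it leaves \<open>p b\<close>
    unchanged.\<close>
  moreover have "\<phi> x = p (\<psi> x)" if "x \<in> arrows G" for x
  proof -
    obtain b where b: "(x, b) \<in> S" using lift \<open>x \<in> arrows G\<close> by blast
    then show ?thesis using psi[OF b] g_A[OF b] by (simp add: p.diff Sigma_set_def)
  qed
  ultimately show ?thesis by (auto simp: continuous_cocycle_def)
qed

text \<open>The fibre over \<open>x\<close> is a coset of \<open>A\<close> containing
  \<open>\<psi> x\<close>, so subtracting \<open>\<psi> x\<close> moves it onto \<open>A\<close>.
  The inclusion is preserved because \<open>\<psi>\<close> vanishes on units. A proper isomorphism
  is defined by a morphism alone, so no inverse is constructed.\<close>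

lemma properly_isomorphic_trivial_if_lift:
  assumes psi: "continuous_cocycle G \<psi>" and lift: "\<And>x. x \<in> arrows G \<Longrightarrow> \<phi> x = p (\<psi> x)"
  shows "properly_isomorphic G A E (\<lambda>(u, a). (u, a)) fst (prod_groupoid G A) (\<lambda>(u, a). (u, a)) fst"
proof -
  define f where "f = (\<lambda>z. (fst z, snd z - \<psi> (fst z)))"
  have mul: "\<psi> (gmul G x y) = \<psi> x + \<psi> y" if "(x, y) \<in> composable G" for x y
    using psi that by (auto simp: continuous_cocycle_def)
  have unit: "\<psi> u = 0" if "u \<in> units G" for u
    using mul[OF unit_composable[OF that]] unit_mul_unit[OF that] by simp
  have f_S: "f z \<in> arrows G \<times> A" if "z \<in> S" for z
    using that lift by (auto simp: f_def Sigma_set_def hom_kernel_def p.diff)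
  have "groupoid_hom E (prod_groupoid G A) f"
    unfolding groupoid_hom_def
  proof (intro conjI ballI)
    show "f ` arrows E \<subseteq> arrows (prod_groupoid G A)"
      using f_S by (simp add: arrows_Sigma_groupoid image_subset_iff)
    fix zw assume zw: "zw \<in> composable E"
    obtain z w where [simp]: "zw = (z, w)" by (rule prod.exhaust)
    have zw: "z \<in> S" "w \<in> S" "(fst z, fst w) \<in> composable G"
      using zw by (auto simp: composable_Sigma_groupoid)
    have "(f z, f w) \<in> composable (prod_groupoid G A)"
      using f_S[OF zw(1)] f_S[OF zw(2)] zw(3) by (auto simp: composable_iff f_def case_prod_unfold)
    moreover have "f (gmul E z w) = gmul (prod_groupoid G A) (f z) (f w)"
      using mul[OF zw(3)] by (simp add: f_def Sigma_groupoid_sel(2) case_prod_unfold)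
    ultimately show "case zw of (x, y) \<Rightarrow> (f x, f y) \<in> composable (prod_groupoid G A) \<and>
        f (gmul E x y) = gmul (prod_groupoid G A) (f x) (f y)"
      by simp
  qed
  moreover have "continuous_map (gtop E) (gtop (prod_groupoid G A)) f"
  proof -
    have "continuous_map (gtop E) euclidean (\<lambda>z. \<psi> (fst z))"
      using continuous_map_compose[OF continuous_projection, of euclidean \<psi>] psi
      by (simp add: continuous_cocycle_def comp_def)
    moreover have "continuous_map (gtop E) euclidean snd"
      by (simp add: Sigma_groupoid_sel continuous_map_from_subtopology continuous_map_snd)
    ultimately have "continuous_map (gtop E) euclidean (\<lambda>z. snd z - \<psi> (fst z))"
      by (intro continuous_map_group_diff)
    moreover have "(\<lambda>z. snd z - \<psi> (fst z)) \<in> arrows E \<rightarrow> A"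
      using f_S by (auto simp: arrows_Sigma_groupoid f_def)
    ultimately show ?thesis
      using continuous_projection unfolding f_def
      by (auto simp: continuous_map_in_subtopology intro!: continuous_map_pairedI)
  qed
  ultimately show ?thesis
    unfolding properly_isomorphic_def
    using twist_E twist_trivial unit by (intro conjI exI[of _ f]) (auto simp: f_def)
qed

lemma properly_isomorphic_trivial_iff_lift:
  "properly_isomorphic G A E (\<lambda>(u, a). (u, a)) fst (prod_groupoid G A) (\<lambda>(u, a). (u, a)) fst \<longleftrightarrow>
    (\<exists>\<psi> :: 'a \<Rightarrow> 'b. continuous_cocycle G \<psi> \<and> (\<forall>x \<in> arrows G. \<phi> x = p (\<psi> x)))"
proof
  assume "properly_isomorphic G A E (\<lambda>(u, a). (u, a)) fst (prod_groupoid G A) (\<lambda>(u, a). (u, a)) fst"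
  then obtain f where "groupoid_hom E (prod_groupoid G A) f"
      "continuous_map (gtop E) (gtop (prod_groupoid G A)) f"
      "\<forall>z \<in> arrows E. fst (f z) = fst z" "\<forall>u \<in> units G. \<forall>a \<in> A. f (u, a) = (u, a)"
    unfolding properly_isomorphic_def by auto
  then show "\<exists>\<psi> :: 'a \<Rightarrow> 'b. continuous_cocycle G \<psi> \<and> (\<forall>x \<in> arrows G. \<phi> x = p (\<psi> x))"
    by (intro lift_of_proper_isomorphism[of f]) (simp_all add: arrows_Sigma_groupoid)
qed (blast intro: properly_isomorphic_trivial_if_lift)

section \<open>The etale case\<close>

text \<open>Discreteness gives an open \<open>W\<close> meeting \<open>A\<close> only in 0. Two
  points over the same arrow differ by an element of \<open>A\<close>; if their second coordinates
  are close enough, the difference also lies in \<open>W\<close> and must be 0.\<close>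

lemma local_homeomorphism_projection:
  assumes disc: "top_of_set A = discrete_topology A"
  shows "local_homeomorphism (gtop E) (gtop G) fst"
proof (rule local_homeomorphismI[OF continuous_projection open_map_projection])
  fix z assume z: "z \<in> topspace (gtop E)"
  have "0 \<in> A" using subgroup_A by (simp add: additive_subgroup_def)
  then have "openin (top_of_set A) {0}" unfolding disc by simp
  then obtain W where W: "open W" "{0} = A \<inter> W" by (auto simp: openin_open)
  then obtain V where V: "open V" "0 \<in> V" "\<And>x y. x \<in> V \<Longrightarrow> y \<in> V \<Longrightarrow> x - y \<in> W"
    using open_difference_nbhd[of W] by blast
  let ?U = "(arrows G \<times> {b. b - snd z \<in> V}) \<inter> S"
  have "openin (prod_topology (gtop G) euclidean) (arrows G \<times> {b. b - snd z \<in> V})"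
    using open_translation[OF V(1)] by (simp add: openin_prod_Times_iff)
  then have "openin (gtop E) ?U"
    unfolding Sigma_groupoid_sel openin_subtopology by blast
  moreover have "z \<in> ?U"
    using z V(2) by (auto simp: arrows_Sigma_groupoid Sigma_set_def)
  moreover have "inj_on fst ?U"
  proof (rule inj_onI)
    fix v w assume vw: "v \<in> ?U" "w \<in> ?U" "fst v = fst w"
    then have "p (snd v - snd w) = 0" by (auto simp: Sigma_set_def p.diff)
    moreover have "(snd v - snd z) - (snd w - snd z) \<in> W" using vw by (intro V(3)) auto
    ultimately have "snd v - snd w \<in> A \<inter> W" by (simp add: hom_kernel_def)
    then have "snd v - snd w = 0" unfolding W(2)[symmetric] by simp
    then show "v = w" using vw(3) by (simp add: prod_eq_iff)
  qed
  ultimately show "\<exists>U. openin (gtop E) U \<and> z \<in> U \<and> inj_on fst U" by blast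
qed

text \<open>The two unit spaces are sets in different types. This identification lets range and
  source of \<open>E\<close> be written as composites of local homeomorphisms ending in
  \<open>units E\<close>.\<close>

lemma homeomorphic_map_units:
  "homeomorphic_map (subtopology (gtop G) (units G)) (subtopology (gtop E) (units E)) (\<lambda>u. (u, 0))"
proof -
  have "units G \<times> {0} \<subseteq> S"
    using fibre_over_units subgroup_A by (auto simp: additive_subgroup_def)
  then have "subtopology (gtop E) (units E) =
      prod_topology (subtopology (gtop G) (units G)) (top_of_set {0})"
    by (simp add: units_E Sigma_groupoid_sel(1) subtopology_subtopology inf_absorb2 subtopology_Times)
  moreover have "homeomorphic_maps (subtopology (gtop G) (units G))
      (prod_topology (subtopology (gtop G) (units G)) (top_of_set {0})) (\<lambda>u. (u, 0)) fst"
    unfolding homeomorphic_maps_def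
    by (intro conjI continuous_map_pairedI continuous_map_fst continuous_map_id[unfolded id_def])
      (auto simp: continuous_map_in_subtopology)
  ultimately show ?thesis using homeomorphic_maps_imp_map by metis
qed

lemma etale_E:
  assumes "etale G" and disc: "top_of_set A = discrete_topology A"
  shows "etale E"
proof -
  \<comment> \<open>Here \<open>t\<close> stands for either the range or the source map of
    \<open>G\<close>.\<close>
  have "local_homeomorphism (gtop E) (subtopology (gtop E) (units E)) ((\<lambda>u. (u, 0)) \<circ> (t \<circ> fst))"
    if "local_homeomorphism (gtop G) (subtopology (gtop G) (units G)) t" for t
    by (rule local_homeomorphism_compose[OF
          local_homeomorphism_compose[OF local_homeomorphism_projection[OF disc] that]
          homeomorphic_map_imp_local_homeomorphism[OF homeomorphic_map_units]])
  moreover have "grng E = (\<lambda>u. (u, 0)) \<circ> (grng G \<circ> fst)" "gsrc E = (\<lambda>u. (u, 0)) \<circ> (gsrc G \<circ> fst)"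
    by (auto simp: Sigma_groupoid_sel)
  moreover have "topological_groupoid E"
    using lcsc_groupoid_E by (simp add: lcsc_groupoid_def)
  ultimately show ?thesis using \<open>etale G\<close> by (simp add: etale_def)
qed

end

theorem proposition3p4:
  fixes \<Gamma> :: "'a tgroupoid"
    and p :: "'b::{topological_ab_group_add, t2_space, second_countable_topology} \<Rightarrow>
              'c::{topological_ab_group_add, t2_space, second_countable_topology}"
    and \<phi> :: "'a \<Rightarrow> 'c"
  assumes "lcsc_groupoid \<Gamma>"
    and "\<exists>\<mu>. haar_system \<Gamma> \<mu>"
    and "locally_compact_space (euclidean :: 'b topology)"
    and "locally_compact_space (euclidean :: 'c topology)"
    and "continuous_on UNIV p"
    and "\<And>x y. p (x + y) = p x + p y"
    and "surj p"
    and "continuous_cocycle \<Gamma> \<phi>"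
  shows "(subgroupoid (Sigma_set \<Gamma> p \<phi>) (prod_groupoid \<Gamma> UNIV) \<and>
         closedin (gtop (prod_groupoid \<Gamma> (UNIV :: 'b set))) (Sigma_set \<Gamma> p \<phi>)) \<and>
         (twist \<Gamma> (hom_kernel p) (Sigma_groupoid \<Gamma> p \<phi>) (\<lambda>(u, a). (u, a)) fst) \<and>
         (properly_isomorphic \<Gamma> (hom_kernel p)
           (Sigma_groupoid \<Gamma> p \<phi>) (\<lambda>(u, a). (u, a)) fst
           (prod_groupoid \<Gamma> (hom_kernel p)) (\<lambda>(u, a). (u, a)) fst
         \<longleftrightarrow> (\<exists>\<psi> :: 'a \<Rightarrow> 'b. continuous_cocycle \<Gamma> \<psi> \<and> (\<forall>\<gamma> \<in> arrows \<Gamma>. \<phi> \<gamma> = p (\<psi> \<gamma>)))) \<and>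
         (groupoid_hom (Sigma_groupoid \<Gamma> p \<phi>) \<Gamma> fst \<and>
         continuous_map (gtop (Sigma_groupoid \<Gamma> p \<phi>)) (gtop \<Gamma>) fst \<and>
         fst ` arrows (Sigma_groupoid \<Gamma> p \<phi>) = arrows \<Gamma>) \<and>
         (etale \<Gamma> \<and> top_of_set (hom_kernel p) = discrete_topology (hom_kernel p) \<longrightarrow>
         etale (Sigma_groupoid \<Gamma> p \<phi>) \<and>
         local_homeomorphism (gtop (Sigma_groupoid \<Gamma> p \<phi>)) (gtop \<Gamma>) fst)"
proof -
  have "cocycle_extension \<Gamma> p \<phi>"
    using assms
    by (simp add: cocycle_extension_def cocycle_extension_axioms_def Modules.additive_def)
  then interpret cocycle_extension \<Gamma> p \<phi> .
  show ?thesis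
    using subgroupoid_S closedin_S twist_E properly_isomorphic_trivial_iff_lift groupoid_hom_projection
      continuous_projection fst_S etale_E local_homeomorphism_projection
    by (simp add: arrows_Sigma_groupoid)
qed

end
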